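(* There exist finite words $u$ over $\mathbb{Z}_{\geq 0}$ and $v$ over $\mathbb{Z}_{\geq 0} \cup \{0'\}$, of lengths $|u| = 55$ and $|v| = 18$, such that $\textbf{w}_{4/3} = \tau(\varphi^\infty(0'))$, where $\varphi$ is the morphism on $\mathbb{Z}_{\geq 0} \cup \{0'\}$ given by $\varphi(0') = v\,\varphi(0)$, $\varphi(0) = u\,1$, and $\varphi(n) = u\,(n+2)$ for $n \in \mathbb{Z}_{\geq 1}$.
   Context: Words are finite or infinite sequences of letters, indexed from position $0$; a factor is a contiguous subword. Let $a, b$ be relatively prime positive integers. For a nonempty word $v$ whose length is divisible by $b$, define $v^{a/b} = v^{\lfloor a/b \rfloor} v_0 v_1 \cdots v_{t-1}$, where $t = |v|\,(a/b - \lfloor a/b\rfloor)$; such a word is called an $\frac{a}{b}$-power. A word is $\frac{a}{b}$-power-free if none of its factors is an $\frac{a}{b}$-power. For $\frac{a}{b} > 1$, $\textbf{w}_{a/b}$ denotes the lexicographically least infinite word over the alphabet $\mathbb{Z}_{\geq 0}$ that is $\frac{a}{b}$-power-free. A morphism $\varphi$ on an alphabet $\Sigma$ is a map $\Sigma \to \Sigma^*$, extended to words by concatenation. If $\varphi(c)$ begins with the letter $c$, $\varphi^\infty(c)$ denotes the infinite fixed point of $\varphi$ beginning with $c$. Here $0'$ is a new letter not in $\mathbb{Z}_{\geq 0}$, and $\tau$ is the coding with $\tau(0') = 0$ and $\tau(n) = n$ for $n \in \mathbb{Z}_{\geq 0}$, applied letterwise. *)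

theory Defs
  imports Complex_Main "HOL-Library.Fun_Lexorder"
begin

text \<open>Finite words are lists, infinite words are functions on \<^typ>\<open>nat\<close> (positions start at 0).\<close>

definition pref :: "(nat \<Rightarrow> 'a) \<Rightarrow> nat \<Rightarrow> 'a list" where
  "pref w n = map w [0..<n]"

definition factors :: "(nat \<Rightarrow> 'a) \<Rightarrow> 'a list set" where
  "factors w = {map w [i..<i + n] | i n. True}"

text \<open>The fractional part of a/b is (a mod b)/b, so the length of the incomplete last period is
  |v| (a mod b)/b; the division is exact when b divides |v|.\<close>

definition frac_power :: "'a list \<Rightarrow> nat \<Rightarrow> nat \<Rightarrow> 'a list" where
  "frac_power v a b = concat (replicate (a div b) v) @ take (length v * (a mod b) div b) v"

definition is_frac_power :: "nat \<Rightarrow> nat \<Rightarrow> 'a list \<Rightarrow> bool" where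
  "is_frac_power a b x \<longleftrightarrow> (\<exists>v. v \<noteq> [] \<and> b dvd length v \<and> x = frac_power v a b)"

definition frac_power_free :: "nat \<Rightarrow> nat \<Rightarrow> (nat \<Rightarrow> 'a) \<Rightarrow> bool" where
  "frac_power_free a b w \<longleftrightarrow> (\<forall>x \<in> factors w. \<not> is_frac_power a b x)"

definition is_lex_least_free :: "nat \<Rightarrow> nat \<Rightarrow> (nat \<Rightarrow> nat) \<Rightarrow> bool" where
  "is_lex_least_free a b w \<longleftrightarrow>
     frac_power_free a b w \<and> (\<forall>x. frac_power_free a b x \<longrightarrow> x = w \<or> less_fun w x)"

text \<open>The word \<open>w\<^sub>a\<^sub>/\<^sub>b\<close>; lemma \<open>lex_least_word\<close> below shows that it is well defined for a/b > 1.\<close>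

definition lex_least_word :: "nat \<Rightarrow> nat \<Rightarrow> (nat \<Rightarrow> nat)" where
  "lex_least_word a b = (THE w. is_lex_least_free a b w)"

text \<open>A morphism is given by its values on letters.\<close>

definition morph :: "('a \<Rightarrow> 'b list) \<Rightarrow> 'a list \<Rightarrow> 'b list" where
  "morph \<phi> w = concat (map \<phi> w)"

text \<open>The infinite word \<open>y\<close> is the concatenation of \<open>\<phi> (x 0)\<close>, \<open>\<phi> (x 1)\<close>, \<open>\<phi> (x 2)\<close>, ...\<close>

definition is_morph_image :: "('a \<Rightarrow> 'b list) \<Rightarrow> (nat \<Rightarrow> 'a) \<Rightarrow> (nat \<Rightarrow> 'b) \<Rightarrow> bool" where
  "is_morph_image \<phi> x y \<longleftrightarrow>
     (\<forall>n. morph \<phi> (pref x n) = pref y (length (morph \<phi> (pref x n)))) \<and>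
     (\<forall>m. \<exists>n. m \<le> length (morph \<phi> (pref x n)))"

text \<open>The word \<open>\<phi>\<^sup>\<infinity>(c)\<close>; see lemma \<open>fixed_word\<close> below for well-definedness.\<close>

definition fixed_word :: "('a \<Rightarrow> 'a list) \<Rightarrow> 'a \<Rightarrow> (nat \<Rightarrow> 'a)" where
  "fixed_word \<phi> c = (THE x. x 0 = c \<and> is_morph_image \<phi> x x)"

text \<open>The alphabet of nonnegative integers with an additional letter \<open>Zero'\<close>.\<close>

datatype letter = Zero' | Num nat

fun \<tau> :: "letter \<Rightarrow> nat" where
  "\<tau> Zero' = 0"
| "\<tau> (Num n) = n"

function phi :: "nat list \<Rightarrow> letter list \<Rightarrow> letter \<Rightarrow> letter list" where
  "phi u v Zero' = v @ phi u v (Num 0)"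
| "phi u v (Num n) = map Num u @ [Num (if n = 0 then 1 else n + 2)]"
  by pat_completeness auto
termination
  by (relation "measure (\<lambda>(u, v, l). if l = Zero' then 1 else 0)") auto


subsection \<open>Well-definedness\<close>

lemma ex_frac_power_free:
  assumes "0 < b" "b < a"
  shows "frac_power_free a b (\<lambda>n::nat. n)"
  unfolding frac_power_free_def
proof (intro ballI notI)
  fix x :: "nat list"
  assume "x \<in> factors (\<lambda>n. n)" "is_frac_power a b x"
  then obtain v i n where v: "v \<noteq> []" "b dvd length v" "x = frac_power v a b"
    and x: "x = [i..<i + n]"
    by (auto simp: factors_def is_frac_power_def)
  have dist: "distinct x" using x by simp
  obtain c where c: "length v = b * c" using v(2) by blast
  have c0: "c > 0" using v(1) c by (cases c) auto
  have ge: "a div b \<ge> 1" using assms by (simp add: Suc_le_eq div_greater_zero_iff)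
  show False
  proof (cases "a div b \<ge> 2")
    case True
    then obtain k where "a div b = 2 + k" using le_Suc_ex by blast
    then have "x = v @ v @ concat (replicate k v) @ take (length v * (a mod b) div b) v"
      using v(3) by (simp add: frac_power_def)
    then show False using dist v(1) by auto
  next
    case False
    then have d1: "a div b = 1" using ge by simp
    have "a mod b > 0" using assms d1 div_mult_mod_eq[of a b] by (cases "a mod b") auto
    then have "length v * (a mod b) div b > 0" using c c0 assms(1)
      by (simp add: mult.assoc)
    then have "take (length v * (a mod b) div b) v \<noteq> []" using v(1) by simp
    then obtain y where "y \<in> set (take (length v * (a mod b) div b) v)"
      using hd_in_set by blast
    moreover have "x = v @ take (length v * (a mod b) div b) v"
      using v(3) d1 by (simp add: frac_power_def)
    ultimately show False using dist by (auto dest: in_set_takeD)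
  qed
qed

lemma frac_power_free_closed:
  assumes "\<And>n. \<exists>x. frac_power_free a b x \<and> pref x n = pref w n"
  shows "frac_power_free a b w"
  unfolding frac_power_free_def
proof
  fix f assume "f \<in> factors w"
  then obtain i n where f: "f = map w [i..<i + n]" by (auto simp: factors_def)
  obtain x where x: "frac_power_free a b x" "pref x (i + n) = pref w (i + n)"
    using assms by blast
  have "\<forall>j<i + n. x j = w j" using x(2) by (auto simp: pref_def)
  then have "f = map x [i..<i + n]" using f by auto
  then have "f \<in> factors x" by (auto simp: factors_def)
  then show "\<not> is_frac_power a b f" using x(1) by (auto simp: frac_power_free_def)
qed

lemma ex1_lex_least_free:
  assumes "0 < b" "b < a"
  shows "\<exists>!w. is_lex_least_free a b w"
proof (rule ex_ex1I)
  let ?P = "frac_power_free a b :: (nat \<Rightarrow> nat) \<Rightarrow> bool"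
  define g where "g l = (LEAST c. \<exists>x. ?P x \<and> pref x (Suc (length l)) = l @ [c])" for l
  define p where "p n = rec_nat [] (\<lambda>_ l. l @ [g l]) n" for n :: nat
  define w where "w n = g (p n)" for n
  have p0: "p 0 = []" and pS: "p (Suc n) = p n @ [w n]" for n
    by (simp_all add: p_def w_def)
  have pw: "p n = pref w n" for n
    by (induction n) (simp_all add: p0 pS pref_def)
  have lenp: "length (p n) = n" for n by (simp add: pw pref_def)
  have inv: "\<exists>x. ?P x \<and> pref x n = p n" for n
  proof (induction n)
    case 0
    show ?case using ex_frac_power_free[OF assms] by (auto simp: pref_def p0)
  next
    case (Suc n)
    then obtain x where "?P x" "pref x n = p n" by blast
    then have "\<exists>c. \<exists>x. ?P x \<and> pref x (Suc (length (p n))) = p n @ [c]"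
      by (intro exI[of _ "x n"] exI[of _ x]) (simp add: lenp pref_def)
    from LeastI_ex[OF this] show ?case
      by (simp add: pS w_def g_def lenp)
  qed
  have free: "?P w" using inv pw by (intro frac_power_free_closed) auto
  have "less_fun w x" if x: "?P x" "x \<noteq> w" for x
  proof -
    define k where "k = (LEAST k. x k \<noteq> w k)"
    have ex: "\<exists>k. x k \<noteq> w k" using x(2) by auto
    have k: "x k \<noteq> w k" unfolding k_def by (rule LeastI_ex[OF ex])
    have lt: "x j = w j" if "j < k" for j
      using not_less_Least that unfolding k_def by blast
    have "pref x (Suc (length (p k))) = p k @ [x k]"
      using lt by (simp add: lenp pw pref_def)
    then have "w k \<le> x k" unfolding w_def g_def using x(1) by (intro Least_le) blast
    then have "w k < x k" using k by simp
    then show ?thesis using lt by (auto simp: less_fun_def)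
  qed
  then show "\<exists>w. is_lex_least_free a b w"
    using free unfolding is_lex_least_free_def by blast
next
  fix w x assume "is_lex_least_free a b w" "is_lex_least_free a b x"
  then show "w = x"
    unfolding is_lex_least_free_def by (metis less_fun_asym)
qed

lemma lex_least_word:
  assumes "0 < b" "b < a"
  shows "is_lex_least_free a b (lex_least_word a b)"
  unfolding lex_least_word_def by (rule theI'[OF ex1_lex_least_free[OF assms]])

lemma pref_take: "m \<le> n \<Longrightarrow> pref x m = take m (pref x n)"
  by (simp add: pref_def take_map)

lemma length_pref [simp]: "length (pref x n) = n"
  by (simp add: pref_def)

lemma morph_append: "morph \<phi> (x @ y) = morph \<phi> x @ morph \<phi> y"
  by (simp add: morph_def)

lemma length_morph_ge:
  assumes "\<And>d. \<phi> d \<noteq> []"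
  shows "length x \<le> length (morph \<phi> x)"
proof (induction x)
  case (Cons d x)
  have "length (\<phi> d) \<ge> 1" using assms[of d] by (cases "\<phi> d") auto
  then show ?case using Cons by (simp add: morph_def)
qed (simp add: morph_def)

lemma fixed_word_aux:
  assumes c: "\<phi> c = c # s" "s \<noteq> []" and ne: "\<And>d. \<phi> d \<noteq> []"
  defines "X \<equiv> \<lambda>n. (morph \<phi> ^^ n) [c]"
  shows "\<exists>!x. x 0 = c \<and> is_morph_image \<phi> x x"
    and "x 0 = c \<Longrightarrow> is_morph_image \<phi> x x \<Longrightarrow> X n = pref x (length (X n))"
    and "n < length (X n)"
proof -
  have XS: "X (Suc n) = morph \<phi> (X n)" for n by (simp add: X_def)
  have X0: "X 0 = [c]" by (simp add: X_def)
  have step: "\<exists>t. t \<noteq> [] \<and> X (Suc n) = X n @ t" for n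
  proof (induction n)
    case 0
    show ?case using c by (simp add: XS X0 morph_def)
  next
    case (Suc n)
    then obtain t where t: "t \<noteq> []" "X (Suc n) = X n @ t" by blast
    have "morph \<phi> t \<noteq> []" using length_morph_ge[of \<phi> t] ne t(1) by auto
    moreover have "X (Suc (Suc n)) = X (Suc n) @ morph \<phi> t"
      using XS[of "Suc n"] XS[of n] t(2) morph_append[of \<phi> "X n" t] by metis
    ultimately show ?case by blast
  qed
  have len: "n < length (X n)" for n
  proof (induction n)
    case (Suc n)
    obtain t where "t \<noteq> []" "X (Suc n) = X n @ t" using step by blast
    then show ?case using Suc by (cases t) auto
  qed (simp add: X0)
  then show "n < length (X n)" .
  have mono: "\<exists>t. X (n + k) = X n @ t" for n k
  proof (induction k)
    case (Suc k)
    then show ?case using step[of "n + k"] by auto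
  qed simp
  have nth: "X m ! i = X n ! i" if "i < length (X n)" "i < length (X m)" for m n i
  proof -
    have *: "X m ! i = X n ! i" if "n \<le> m" "i < length (X n)" for m n
      using mono[of n "m - n"] that by (auto simp: nth_append)
    show ?thesis using *[of n m] *[of m n] that by (cases "n \<le> m") auto
  qed
  have unique: "X n = pref x (length (X n))" if x: "x 0 = c" "is_morph_image \<phi> x x" for x :: "nat \<Rightarrow> _" and n
  proof (induction n)
    case 0
    show ?case using x by (simp add: X0 pref_def)
  next
    case (Suc n)
    have "morph \<phi> (pref x (length (X n))) =
          pref x (length (morph \<phi> (pref x (length (X n)))))"
      using x(2) unfolding is_morph_image_def by blast
    then show ?case using Suc XS[of n] by metis
  qed
  show "x 0 = c \<Longrightarrow> is_morph_image \<phi> x x \<Longrightarrow> X n = pref x (length (X n))"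
    by (rule unique)
  define y where "y i = X i ! i" for i
  have Xy: "X n = pref y (length (X n))" for n
    by (rule nth_equalityI) (auto simp: pref_def y_def intro: nth len)
  show "\<exists>!x. x 0 = c \<and> is_morph_image \<phi> x x"
  proof (rule ex1I[of _ y])
    have "morph \<phi> (pref y n) = pref y (length (morph \<phi> (pref y n)))" for n
    proof -
      have "pref y n = take n (X n)" using len[of n] Xy[of n] pref_take[of n "length (X n)" y] by (metis less_imp_le)
      then have "X n = pref y n @ drop n (X n)" by (metis append_take_drop_id)
      then have e: "X (Suc n) = morph \<phi> (pref y n) @ morph \<phi> (drop n (X n))"
        using XS[of n] morph_append by metis
      then have le: "length (morph \<phi> (pref y n)) \<le> length (X (Suc n))" by simp
      from e have "morph \<phi> (pref y n) = take (length (morph \<phi> (pref y n))) (X (Suc n))" by simp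
      also have "\<dots> = pref y (length (morph \<phi> (pref y n)))"
        using Xy[of "Suc n"] pref_take[of "length (morph \<phi> (pref y n))" "length (X (Suc n))" y] le
        by metis
      finally show ?thesis .
    qed
    moreover have "\<exists>n. m \<le> length (morph \<phi> (pref y n))" for m
      using length_morph_ge[of \<phi> "pref y m"] ne by (intro exI[of _ m]) simp
    moreover have "y 0 = c" by (simp add: y_def X0)
    ultimately show "y 0 = c \<and> is_morph_image \<phi> y y" by (simp add: is_morph_image_def)
  next
    fix x assume x: "x 0 = c \<and> is_morph_image \<phi> x x"
    show "x = y"
    proof
      fix i
      have "X i = pref x (length (X i))" using unique x by blast
      then have "X i ! i = pref x (length (X i)) ! i" by metis
      then show "x i = y i" using len[of i] by (simp add: y_def pref_def)
    qed
  qed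
qed

lemma fixed_word:
  assumes "\<phi> c = c # s" "s \<noteq> []" "\<And>d. \<phi> d \<noteq> []"
  shows "fixed_word \<phi> c 0 = c \<and> is_morph_image \<phi> (fixed_word \<phi> c) (fixed_word \<phi> c)"
proof -
  have "\<exists>!x. x 0 = c \<and> is_morph_image \<phi> x x"
    using assms by (rule fixed_word_aux(1))
  from theI'[OF this] show ?thesis unfolding fixed_word_def .
qed

end

theory Submission
  imports Defs "HOL-Library.Code_Binary_Nat"
begin

text \<open>
  With \<open>f 0 = 1\<close> and \<open>f n = n + 2\<close> for \<open>n \<ge> 1\<close>, the claimed word \<open>w\<close> consists of the prefix \<open>v\<close>
  followed by rows \<open>u (f (w q))\<close> of length 56, for \<open>q = 0, 1, 2, \<dots>\<close>. A 4/3-power with period \<open>3m\<close>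
  compares a block of length \<open>m\<close> with its shift by \<open>3m\<close>.

  Power-freeness: \<open>f\<close> omits the values 0 and 2, so identifying all letters other than 0 and 2 makes
  \<open>w\<close> periodic with period 56 after the prefix, and a finite check produces a mismatch for every \<open>m\<close>
  not divisible by 56. If \<open>m = 56k\<close>, then reading off the last column and cancelling the injective
  map \<open>f\<close> gives a 4/3-power with block length \<open>k\<close>.

  Minimality: lowering a letter inside \<open>u\<close> or \<open>v\<close>, or lowering \<open>f (w q)\<close> to 0 or 2, always completes
  a 4/3-power with a short block (finite check). Any other smaller value of \<open>f (w q)\<close> is \<open>f c\<close> with
  \<open>c < w q\<close>, and the power completed by writing \<open>c\<close> at position \<open>q\<close> lifts to one with a block 56
  times as long.
\<close>

section \<open>4/3-powers\<close>

lemma frac_power_free_4_3_iff: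
  "frac_power_free 4 3 w \<longleftrightarrow> (\<forall>i m. 0 < m \<longrightarrow> (\<exists>j<m. w (i + j) \<noteq> w (i + 3 * m + j)))"
proof -
  have pow: "frac_power x 4 3 = x @ take (length x div 3) x" for x :: "'a list"
    by (simp add: frac_power_def)
  show ?thesis
  proof (intro iffI allI impI)
    fix i m :: nat
    assume free: "frac_power_free 4 3 w" and m: "0 < m"
    show "\<exists>j<m. w (i + j) \<noteq> w (i + 3 * m + j)"
    proof (rule ccontr)
      assume "\<not> ?thesis"
      then have eq: "w (i + 3 * m + j) = w (i + j)" if "j < m" for j
        using that by auto
      let ?x = "map w [i..<i + 3 * m]"
      have "map w [i..<i + 4 * m] = frac_power ?x 4 3"
      proof (rule nth_equalityI)
        fix k assume "k < length (map w [i..<i + 4 * m])"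
        then show "map w [i..<i + 4 * m] ! k = frac_power ?x 4 3 ! k"
          using eq[of "k - 3 * m"] by (auto simp: pow nth_append add.assoc)
      qed (simp add: pow)
      then have "is_frac_power 4 3 (map w [i..<i + 4 * m])"
        unfolding is_frac_power_def using m by (intro exI[of _ ?x]) auto
      then show False
        using free by (auto simp: frac_power_free_def factors_def)
    qed
  next
    assume mis: "\<forall>i m. 0 < m \<longrightarrow> (\<exists>j<m. w (i + j) \<noteq> w (i + 3 * m + j))"
    show "frac_power_free 4 3 w"
      unfolding frac_power_free_def
    proof (intro ballI notI)
      fix y assume "y \<in> factors w" "is_frac_power 4 3 y"
      then obtain i n x where y: "y = map w [i..<i + n]" "y = x @ take (length x div 3) x"
        and x: "x \<noteq> []" "3 dvd length x"
        unfolding factors_def is_frac_power_def pow by blast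
      from x obtain m where m: "length x = 3 * m" "0 < m"
        by (metis dvdE length_greater_0_conv nat_0_less_mult_iff)
      have n: "n = 4 * m"
        using arg_cong[OF y(1), of length] arg_cong[OF y(2), of length] m by simp
      have "w (i + j) = w (i + 3 * m + j)" if j: "j < m" for j
      proof -
        have "w (i + j) = y ! j" "w (i + 3 * m + j) = y ! (3 * m + j)"
          using j n by (simp_all add: y(1) add.assoc)
        moreover have "y ! j = x ! j" "y ! (3 * m + j) = x ! j"
          using j m by (simp_all add: y(2) nth_append)
        ultimately show ?thesis by simp
      qed
      then show False using mis m(2) by blast
    qed
  qed
qed

text \<open>The premise says that writing a smaller \<open>c\<close> at position \<open>n\<close>
  completes a 4/3-power ending exactly there. At its first difference from \<open>w\<close>, a
  power-free \<open>x\<close> with the smaller letter would contain this power.\<close>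

lemma is_lex_least_free_4_3I:
  assumes free: "frac_power_free 4 3 w"
    and least: "\<And>n c. c < w n \<Longrightarrow>
      \<exists>m>0. 4 * m \<le> n + 1 \<and> w (n - 3 * m) = c \<and> (\<forall>j<m. 0 < j \<longrightarrow> w (n - j) = w (n - 3 * m - j))"
  shows "is_lex_least_free 4 3 w"
  unfolding is_lex_least_free_def
proof (intro conjI allI impI)
  fix x :: "nat \<Rightarrow> nat" assume x: "frac_power_free 4 3 x"
  show "x = w \<or> less_fun w x"
  proof (cases "x = w")
    case False
    define n where "n = (LEAST n. x n \<noteq> w n)"
    from False have "\<exists>n. x n \<noteq> w n" by auto
    then have n: "x n \<noteq> w n" unfolding n_def by (rule LeastI_ex)
    have before: "x i = w i" if "i < n" for i
      using that not_less_Least unfolding n_def by blast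
    have "\<not> x n < w n"
    proof
      assume "x n < w n"
      from least[OF this] obtain m where m: "m > 0" "4 * m \<le> n + 1" "w (n - 3 * m) = x n"
        and eq: "\<And>j. j < m \<Longrightarrow> 0 < j \<Longrightarrow> w (n - j) = w (n - 3 * m - j)" by blast
      obtain j where j: "j < m" "x (n + 1 - 4 * m + j) \<noteq> x (n + 1 - 4 * m + 3 * m + j)"
        using x m(1) unfolding frac_power_free_4_3_iff by blast
      \<comment> \<open>Power-freeness indexes the block forwards from its start, the premise
        backwards from \<open>n\<close>; \<open>l\<close> converts, with \<open>l = 0\<close> the
        altered letter.\<close>
      define l where "l = m - 1 - j"
      have idx: "n + 1 - 4 * m + j = n - 3 * m - l" "n + 1 - 4 * m + 3 * m + j = n - l"
        and l: "l < m" "l \<le> n"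
        using j(1) m(1,2) by (simp_all add: l_def)
      have "x (n - 3 * m - l) = w (n - 3 * m - l)"
        using m by (intro before) auto
      moreover have "x (n - l) = w (n - 3 * m - l)"
        using before[of "n - l"] eq[of l] l m(3) by (cases "l = 0") auto
      ultimately show False using j(2) idx by simp
    qed
    with n have "w n < x n" by simp
    then show ?thesis using before by (auto simp: less_fun_def)
  qed simp
qed (rule free)

section \<open>The candidate word\<close>

definition u_word :: "nat list" where
  "u_word = [1,2,0,2,1,1,0,0,0,1,1,2,0,2,0,2,0,1,0,1,0,1,0,2,0,2,1,1,1,0,0,0,1,2,1,2,0,2,0,1,0,1,0,1,
     0,2,0,2,0,2,1,1,0,0,0]"

definition v_word :: "nat list" where
  "v_word = [0,0,0,1,1,1,0,2,0,2,0,1,1,1,0,0,0,2]"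

definition last_col :: "nat \<Rightarrow> nat" where
  "last_col n = (if n = 0 then 1 else n + 2)"

fun cand :: "nat \<Rightarrow> nat" where
  "cand n = (if n < 18 then v_word ! n
     else if (n - 18) mod 56 < 55 then u_word ! ((n - 18) mod 56)
     else last_col (cand ((n - 18) div 56)))"

declare cand.simps [simp del]

lemma length_u_word [simp]: "length u_word = 55"
  by (simp add: u_word_def)

lemma length_v_word [simp]: "length v_word = 18"
  by (simp add: v_word_def)

lemma cand_prefix: "n < 18 \<Longrightarrow> cand n = v_word ! n"
  by (simp add: cand.simps)

lemma cand_col: "k mod 56 < 55 \<Longrightarrow> cand (18 + k) = u_word ! (k mod 56)"
  by (simp add: cand.simps[of "18 + k"])

lemma cand_last_col: "cand (73 + 56 * q) = last_col (cand q)"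
proof -
  have "(55 + 56 * q) mod 56 = 55" "(55 + 56 * q) div 56 = q" by presburger+
  then show ?thesis by (simp add: cand.simps[of "73 + 56 * q"])
qed

lemma last_col_neq: "last_col n \<noteq> 0" "last_col n \<noteq> 2"
  by (auto simp: last_col_def)

lemma last_col_eq_iff [simp]: "last_col m = last_col n \<longleftrightarrow> m = n"
  by (auto simp: last_col_def)

text \<open>\<open>last_col\<close> is strictly increasing and its image omits only 0 and 2.\<close>

lemma less_last_colD:
  assumes "c < last_col n"
  shows "c \<in> {0, 2} \<or> (\<exists>k<n. c = last_col k)"
proof (cases "c \<in> {0, 2}")
  case False
  then have "c = last_col (if c = 1 then 0 else c - 2)" "(if c = 1 then 0 else c - 2) < n"
    using assms by (auto simp: last_col_def split: if_splits)
  then show ?thesis by blast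
qed simp

section \<open>Power-freeness\<close>

text \<open>This removes the recursion: the last column becomes constantly 1, while
  \<open>u_word\<close> and \<open>v_word\<close>, whose letters are 0, 1 and 2, stay unchanged. A
  mismatch of squashed letters is a mismatch in \<open>cand\<close>.\<close>

definition squash :: "nat \<Rightarrow> nat" where
  "squash n = (if n = 0 \<or> n = 2 then n else 1)"

lemma squash_cand_row: "squash (cand (18 + k)) = (u_word @ [1]) ! (k mod 56)"
proof (cases "k mod 56 < 55")
  case True
  have "\<forall>r\<in>set [0..<55]. squash (u_word ! r) = u_word ! r"
    by code_simp
  with True show ?thesis by (simp add: cand_col nth_append)
next
  case False
  then have r: "k mod 56 = 55"
    using mod_less_divisor[of 56 k] by linarith
  then have "k = 55 + 56 * (k div 56)"
    using mult_div_mod_eq[of 56 k] by linarith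
  then have "18 + k = 73 + 56 * (k div 56)"
    by simp
  then have "squash (cand (18 + k)) = 1"
    using last_col_neq by (metis cand_last_col squash_def)
  then show ?thesis using r by (simp add: nth_append)
qed

lemma squash_cand_prefix:
  assumes "n < 186"
  shows "squash (cand n) = (v_word @ u_word @ [1] @ u_word @ [1] @ u_word @ [1]) ! n"
proof (cases "n < 18")
  case True
  have "\<forall>r\<in>set [0..<18]. squash (v_word ! r) = v_word ! r"
    by code_simp
  with True show ?thesis by (simp add: cand_prefix nth_append)
next
  case False
  then obtain k where k: "n = 18 + k" by (metis le_Suc_ex not_le)
  have "\<forall>k\<in>set [0..<168]. (u_word @ [1] @ u_word @ [1] @ u_word @ [1]) ! k = (u_word @ [1]) ! (k mod 56)"
    by code_simp
  with assms show ?thesis by (simp add: k squash_cand_row nth_append_right)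
qed

text \<open>Here \<open>r\<close> is the column where the block starts and \<open>s\<close> is
  \<open>m mod 56\<close>; shifting by \<open>3 * m\<close> moves columns as \<open>3 * s\<close>
  does. The bound \<open>s\<close> keeps \<open>j\<close> inside the block, and the bound 14 serves
  long blocks that start in the prefix.\<close>

lemma cols_mismatch_check:
  "\<forall>s\<in>set [1..<56]. \<forall>r\<in>set [0..<56]. \<exists>j\<in>set [0..<min s 14].
     (u_word @ [1]) ! ((r + j) mod 56) \<noteq> (u_word @ [1]) ! ((r + j + 3 * s) mod 56)"
  by code_simp

text \<open>The last position compared is at most 17 + 4 * 31 - 1 = 140, so the prefix and three
  rows suffice.\<close>

lemma prefix_mismatch_check:
  "\<forall>i\<in>set [0..<18]. \<forall>m\<in>set [1..<32]. \<exists>j\<in>set [0..<m].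
     (v_word @ u_word @ [1] @ u_word @ [1] @ u_word @ [1]) ! (i + j) \<noteq>
     (v_word @ u_word @ [1] @ u_word @ [1] @ u_word @ [1]) ! (i + 3 * m + j)"
  by code_simp

lemma cand_mismatch_rows:
  assumes "\<not> 56 dvd m"
  shows "\<exists>j<min m 14. cand (18 + t + j) \<noteq> cand (18 + t + 3 * m + j)"
proof -
  define s r where "s = m mod 56" and "r = t mod 56"
  have "s \<in> set [1..<56]" "r \<in> set [0..<56]"
    using assms by (auto simp: s_def r_def dvd_eq_mod_eq_0 Suc_le_eq)
  then obtain j where j: "j < min s 14"
    "(u_word @ [1]) ! ((r + j) mod 56) \<noteq> (u_word @ [1]) ! ((r + j + 3 * s) mod 56)"
    using cols_mismatch_check by fastforce
  obtain a b where "t = 56 * a + r" "m = 56 * b + s"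
    unfolding r_def s_def by (metis mult_div_mod_eq)
  then have "t + j = r + j + 56 * a" "t + 3 * m + j = r + j + 3 * s + 56 * (a + 3 * b)"
    by simp_all
  then have "(r + j) mod 56 = (t + j) mod 56" "(r + j + 3 * s) mod 56 = (t + 3 * m + j) mod 56"
    by (metis mod_mult_self2)+
  then have "squash (cand (18 + (t + j))) \<noteq> squash (cand (18 + (t + 3 * m + j)))"
    using j(2) by (simp only: squash_cand_row not_False_eq_True)
  then have "cand (18 + t + j) \<noteq> cand (18 + t + 3 * m + j)"
    by (metis add.assoc)
  moreover have "s \<le> m" by (simp add: s_def)
  ultimately show ?thesis using j(1) by (intro exI[of _ j]) auto
qed

lemma cand_mismatch:
  assumes "0 < m"
  shows "\<exists>j<m. cand (i + j) \<noteq> cand (i + 3 * m + j)"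
  using assms
proof (induction m arbitrary: i rule: less_induct)
  case (less m)
  show ?case
  proof (cases "56 dvd m")
    case True
    then obtain k where k: "m = 56 * k" by blast
    with less.prems have "0 < k" by simp
    show ?thesis
    proof (cases "i < 18")
      case True
      \<comment> \<open>The block contains position 17, where the prefix ends with the letter 2.
        Shifting by a multiple of 56 leads from there to the last column, which never contains
        2.\<close>
      then have "i + (17 - i) = 17" "i + 3 * m + (17 - i) = 73 + 56 * (3 * k - 1)"
        using \<open>0 < k\<close> by (simp_all add: k)
      moreover have "cand 17 = 2"
        by (simp add: cand_prefix v_word_def)
      ultimately have "cand (i + (17 - i)) \<noteq> cand (i + 3 * m + (17 - i))"
        by (metis cand_last_col last_col_neq(2))
      moreover have "17 - i < m" using \<open>0 < k\<close> by (simp add: k)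
      ultimately show ?thesis by blast
    next
      case False
      then obtain t where t: "i = 18 + t" by (metis le_Suc_ex not_le)
      define q where "q = t div 56"
      obtain j where j: "j < k" "cand (q + j) \<noteq> cand (q + 3 * k + j)"
        using less.IH[of k q] \<open>0 < k\<close> by (auto simp: k)
      \<comment> \<open>\<open>J\<close> is the distance from \<open>i\<close>, which lies in row
        \<open>q\<close>, to the last column of row \<open>q + j\<close>.\<close>
      define J where "J = 55 - t mod 56 + 56 * j"
      have "t mod 56 \<le> 55"
        using mod_less_divisor[of 56 t] by linarith
      moreover have "t = 56 * q + t mod 56"
        by (simp add: q_def)
      ultimately have "i + J = 73 + 56 * (q + j)"
        by (simp add: t J_def)
      then have "i + J = 73 + 56 * (q + j)" "i + 3 * m + J = 73 + 56 * (q + 3 * k + j)"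
        by (simp_all add: k)
      then have "cand (i + J) \<noteq> cand (i + 3 * m + J)"
        using j(2) by (metis cand_last_col last_col_eq_iff)
      moreover have "J < m" using j(1) by (simp add: J_def k)
      ultimately show ?thesis by blast
    qed
  next
    case ndvd: False
    \<comment> \<open>A block starting in the prefix with \<open>m\<close> \<ge> 32 covers positions
      18 to 31, the 14 letters in which the row check finds a mismatch.\<close>
    consider "18 \<le> i" | "i < 18" "32 \<le> m" | "i < 18" "m < 32" by linarith
    then show ?thesis
    proof cases
      case 1
      then show ?thesis
        using cand_mismatch_rows[OF ndvd, of "i - 18"] by auto
    next
      case 2
      obtain j where "j < 14" "cand (18 + j) \<noteq> cand (18 + 3 * m + j)"
        using cand_mismatch_rows[OF ndvd, of 0] by auto
      then show ?thesis
        using 2 by (intro exI[of _ "18 - i + j"]) (auto simp: ac_simps)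
    next
      case 3
      then have "i \<in> set [0..<18]" "m \<in> set [1..<32]"
        using less.prems by auto
      then obtain j where "j < m"
        "(v_word @ u_word @ [1] @ u_word @ [1] @ u_word @ [1]) ! (i + j) \<noteq>
         (v_word @ u_word @ [1] @ u_word @ [1] @ u_word @ [1]) ! (i + 3 * m + j)"
        using prefix_mismatch_check by fastforce
      moreover from this 3 have "i + j < 186" "i + 3 * m + j < 186" by auto
      ultimately show ?thesis by (metis squash_cand_prefix)
    qed
  qed
qed

section \<open>Minimality\<close>

text \<open>Blocks of length at most 4 suffice. The conditions \<open>< 55\<close> keep the compared
  positions, apart from the altered one, out of the last column, whose letters depend on the row.
  Adding 56 avoids truncated subtraction.\<close>

lemma cols_least_check:
  "\<forall>r\<in>set [0..<56]. \<forall>c\<in>set (if r < 55 then [0..<u_word ! r] else [0, 2]). \<exists>m\<in>set [1..<5].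
     (r + 56 - 3 * m) mod 56 < 55 \<and> u_word ! ((r + 56 - 3 * m) mod 56) = c \<and>
     (\<forall>j\<in>set [1..<m]. (r + 56 - j) mod 56 < 55 \<and> (r + 56 - 3 * m - j) mod 56 < 55 \<and>
        u_word ! ((r + 56 - j) mod 56) = u_word ! ((r + 56 - 3 * m - j) mod 56))"
  by code_simp

text \<open>Near the start a power may reach into the prefix, so columns alone do not determine its
  letters. From position 34 on, the short powers, of length at most 16, lie beyond the
  prefix.\<close>

lemma prefix_least_check:
  "\<forall>n\<in>set [0..<34]. \<forall>c\<in>set [0..<(v_word @ u_word) ! n]. \<exists>m\<in>set [1..<9].
     4 * m \<le> n + 1 \<and> (v_word @ u_word) ! (n - 3 * m) = c \<and>
     (\<forall>j\<in>set [1..<m]. (v_word @ u_word) ! (n - j) = (v_word @ u_word) ! (n - 3 * m - j))"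
  by code_simp

lemma cand_short_power:
  assumes k: "16 \<le> k" and c: "c \<in> set (if k mod 56 < 55 then [0..<u_word ! (k mod 56)] else [0, 2])"
  shows "\<exists>m>0. 4 * m \<le> 18 + k + 1 \<and> cand (18 + k - 3 * m) = c \<and>
    (\<forall>j<m. 0 < j \<longrightarrow> cand (18 + k - j) = cand (18 + k - 3 * m - j))"
proof -
  define r where "r = k mod 56"
  have "r \<in> set [0..<56]" by (simp add: r_def)
  with c obtain m where m: "m \<in> set [1..<5]" "(r + 56 - 3 * m) mod 56 < 55"
      "u_word ! ((r + 56 - 3 * m) mod 56) = c"
    and eq: "\<forall>j\<in>set [1..<m]. (r + 56 - j) mod 56 < 55 \<and> (r + 56 - 3 * m - j) mod 56 < 55 \<and>
        u_word ! ((r + 56 - j) mod 56) = u_word ! ((r + 56 - 3 * m - j) mod 56)"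
    using cols_least_check unfolding r_def by fast
  have row: "cand (18 + k - d) = u_word ! ((r + 56 - d) mod 56)"
    if "(r + 56 - d) mod 56 < 55" "d \<le> 15" for d
  proof -
    obtain a where "k = 56 * a + r"
      unfolding r_def by (metis mult_div_mod_eq)
    then have "k - d + 56 = (r + 56 - d) + 56 * a" using that(2) k by simp
    then have "(k - d) mod 56 = (r + 56 - d) mod 56"
      by (metis mod_add_self2 mod_mult_self2)
    moreover have "18 + k - d = 18 + (k - d)" using that(2) k by simp
    ultimately show ?thesis using that(1) cand_col[of "k - d"] by (simp only:)
  qed
  have m4: "0 < m" "m \<le> 4" using m(1) by auto
  have "cand (18 + k - 3 * m) = c"
    using row[of "3 * m"] m m4 by simp
  moreover have "cand (18 + k - j) = cand (18 + k - 3 * m - j)" if j: "j < m" "0 < j" for j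
  proof -
    have "j \<in> set [1..<m]" using j by simp
    then show ?thesis
      using row[of j] row[of "3 * m + j"] eq j m4 by simp
  qed
  ultimately show ?thesis using m4 k by (intro exI[of _ m]) auto
qed

lemma cand_completes_power:
  assumes "c < cand n"
  shows "\<exists>m>0. 4 * m \<le> n + 1 \<and> cand (n - 3 * m) = c \<and>
    (\<forall>j<m. 0 < j \<longrightarrow> cand (n - j) = cand (n - 3 * m - j))"
  using assms
proof (induction n arbitrary: c rule: less_induct)
  case (less n)
  show ?case
  proof (cases "n < 34")
    case True
    have pre: "cand i = (v_word @ u_word) ! i" if "i < 34" for i
      using that cand_col[of "i - 18"] by (cases "i < 18") (auto simp: cand_prefix nth_append)
    have "n \<in> set [0..<34]" "c \<in> set [0..<(v_word @ u_word) ! n]"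
      using True less.prems pre by auto
    then obtain m where "m \<in> set [1..<9]" "4 * m \<le> n + 1" "(v_word @ u_word) ! (n - 3 * m) = c"
      "\<forall>j\<in>set [1..<m]. (v_word @ u_word) ! (n - j) = (v_word @ u_word) ! (n - 3 * m - j)"
      using prefix_least_check by fast
    then show ?thesis
      using True by (intro exI[of _ m]) (auto simp: pre)
  next
    case False
    then obtain k where k: "n = 18 + k" "16 \<le> k"
      by (intro that[of "n - 18"]) auto
    show ?thesis
    proof (cases "k mod 56 < 55")
      case True
      then show ?thesis
        using cand_short_power[OF k(2), of c] less.prems cand_col[OF True] k(1) by simp
    next
      case last: False
      define q where "q = k div 56"
      have r: "k mod 56 = 55"
        using last mod_less_divisor[of 56 k] by linarith
      then have kq: "k = 55 + 56 * q"
        using mult_div_mod_eq[of 56 k] unfolding q_def by linarith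
      then have n: "n = 73 + 56 * q" by (simp add: k(1))
      have "c < last_col (cand q)"
        using less.prems by (simp add: n cand_last_col)
      from less_last_colD[OF this] show ?thesis
      proof
        assume "c \<in> {0, 2}"
        then show ?thesis
          using cand_short_power[OF k(2), of c] r k(1) by simp
      next
        assume "\<exists>d<cand q. c = last_col d"
        then obtain d where d: "d < cand q" "c = last_col d" by blast
        obtain l where l: "l > 0" "4 * l \<le> q + 1" "cand (q - 3 * l) = d"
          and eq: "\<And>j. j < l \<Longrightarrow> 0 < j \<Longrightarrow> cand (q - j) = cand (q - 3 * l - j)"
          using less.IH[of q d] d(1) n by auto
        have "n - 3 * (56 * l) = 73 + 56 * (q - 3 * l)"
          using l(2) by (simp add: n)
        then have "cand (n - 3 * (56 * l)) = c"
          by (simp only: cand_last_col l(3) d(2))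
        \<comment> \<open>Multiples of 56 stay in the last column and inherit the equality from
          \<open>q\<close>. Elsewhere the letter depends only on the column, which a shift by
          \<open>168 * l\<close> preserves.\<close>
        moreover have "cand (n - j) = cand (n - 3 * (56 * l) - j)" if j: "j < 56 * l" "0 < j" for j
        proof (cases "56 dvd j")
          case True
          then obtain i where i: "j = 56 * i" by blast
          with j have "i < l" "0 < i" by simp_all
          moreover have "n - j = 73 + 56 * (q - i)" "n - 3 * (56 * l) - j = 73 + 56 * (q - 3 * l - i)"
            using l(2) \<open>i < l\<close> by (simp_all add: n i)
          ultimately show ?thesis by (simp only: cand_last_col eq)
        next
          case False
          \<comment> \<open>This follows from \<open>4 * l\<close> \<le> \<open>q + 1\<close> and
            keeps the whole lifted power outside the prefix, so no subtraction from \<open>k\<close>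
            is truncated.\<close>
          have kj: "224 * l \<le> k + 1" using l(2) kq by simp
          have "(k - j) mod 56 \<noteq> 55"
          proof
            assume "(k - j) mod 56 = 55"
            then have "56 dvd k - (k - j)"
              using r by (intro mod_eq_dvd_iff_nat[THEN iffD1]) simp_all
            moreover have "k - (k - j) = j" using j(1) kj by simp
            ultimately have "56 dvd j" by (simp only:)
            with False show False ..
          qed
          moreover have "(k - j) mod 56 < 56" by simp
          ultimately have col: "(k - j) mod 56 < 55" by linarith
          have "k - j = k - 3 * (56 * l) - j + 56 * (3 * l)" using j(1) kj by simp
          then have eq': "(k - j) mod 56 = (k - 3 * (56 * l) - j) mod 56"
            by (metis mod_mult_self2)
          have "n - j = 18 + (k - j)" "n - 3 * (56 * l) - j = 18 + (k - 3 * (56 * l) - j)"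
            using j(1) kj by (simp_all add: k(1))
          then show ?thesis
            using cand_col[of "k - j"] cand_col[of "k - 3 * (56 * l) - j"] col eq' by simp
        qed
        ultimately show ?thesis
          using l(1,2) by (intro exI[of _ "56 * l"]) (simp add: n)
      qed
    qed
  qed
qed

lemma lex_least_word_4_3: "lex_least_word 4 3 = cand"
proof -
  have "is_lex_least_free 4 3 cand"
  proof (rule is_lex_least_free_4_3I)
    show "frac_power_free 4 3 cand"
      using cand_mismatch by (auto simp: frac_power_free_4_3_iff)
  qed (rule cand_completes_power)
  then show ?thesis
    using ex1_lex_least_free[of 3 4] lex_least_word[of 3 4] by auto
qed

section \<open>The fixed point\<close>

definition v_letters :: "letter list" where
  "v_letters = Zero' # map Num (tl v_word)"

text \<open>Only position 0 carries \<open>Zero'\<close>: images of \<open>Num\<close> letters never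
  contain it, and \<open>phi u_word v_letters Zero'\<close> has it only at its start.\<close>

definition cand_letters :: "nat \<Rightarrow> letter" where
  "cand_letters n = (if n = 0 then Zero' else Num (cand n))"

lemma length_phi: "length (phi u_word v_letters c) = (if c = Zero' then 74 else 56)"
  by (cases c) (auto simp: v_letters_def)

text \<open>Each letter contributes one row, and the initial \<open>Zero'\<close> contributes the 18
  letters of \<open>v_letters\<close> as well. Hence the form \<open>Suc n\<close>: the empty prefix
  has an empty image.\<close>

lemma morph_pref_cand_letters:
  "morph (phi u_word v_letters) (pref cand_letters (Suc n)) = pref cand_letters (18 + 56 * Suc n)"
proof -
  have row: "map cand_letters [18 + 56 * q..<18 + 56 * Suc q] = map Num u_word @ [Num (last_col (cand q))]" for q
  proof (rule nth_equalityI)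
    fix r assume "r < length (map cand_letters [18 + 56 * q..<18 + 56 * Suc q])"
    then have r: "r < 56" by simp
    then have "map cand_letters [18 + 56 * q..<18 + 56 * Suc q] ! r = Num (cand (18 + (56 * q + r)))"
      by (simp add: cand_letters_def add.assoc)
    also have "\<dots> = (map Num u_word @ [Num (last_col (cand q))]) ! r"
    proof (cases "r < 55")
      case True
      then show ?thesis using cand_col[of "56 * q + r"] by (simp add: nth_append)
    next
      case False
      with r have "r = 55" by simp
      then show ?thesis using cand_last_col[of q] by (simp add: nth_append)
    qed
    finally show "map cand_letters [18 + 56 * q..<18 + 56 * Suc q] ! r =
      (map Num u_word @ [Num (last_col (cand q))]) ! r" .
  qed simp
  have split: "pref cand_letters (18 + 56 * Suc q) =
    pref cand_letters (18 + 56 * q) @ map Num u_word @ [Num (last_col (cand q))]" for q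
  proof -
    have "[0..<18 + 56 * Suc q] = [0..<18 + 56 * q] @ [18 + 56 * q..<18 + 56 * Suc q]"
      using upt_add_eq_append[of 0 "18 + 56 * q" 56] by simp
    then show ?thesis by (simp only: pref_def map_append row)
  qed
  show ?thesis
  proof (induction n)
    case 0
    have "pref cand_letters 18 = v_letters"
      by (rule nth_equalityI)
        (auto simp: pref_def v_letters_def cand_letters_def cand_prefix nth_Cons' nth_tl)
    then have "pref cand_letters (18 + 56 * Suc 0) = v_letters @ map Num u_word @ [Num (last_col (cand 0))]"
      using split[of 0] by simp
    also have "\<dots> = morph (phi u_word v_letters) (pref cand_letters (Suc 0))"
      by (simp add: morph_def pref_def cand_letters_def cand_prefix last_col_def v_word_def)
    finally show ?case ..
  next
    case (Suc n)
    have "pref cand_letters (Suc (Suc n)) = pref cand_letters (Suc n) @ [cand_letters (Suc n)]"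
      by (simp add: pref_def)
    then have "morph (phi u_word v_letters) (pref cand_letters (Suc (Suc n))) =
      pref cand_letters (18 + 56 * Suc n) @ phi u_word v_letters (cand_letters (Suc n))"
      by (simp only: morph_append Suc.IH) (simp add: morph_def)
    also have "phi u_word v_letters (cand_letters (Suc n)) = map Num u_word @ [Num (last_col (cand (Suc n)))]"
      by (simp add: cand_letters_def last_col_def)
    finally show ?case by (simp only: split)
  qed
qed

lemma fixed_word_phi: "fixed_word (phi u_word v_letters) Zero' = cand_letters"
proof -
  have "\<exists>s. phi u_word v_letters Zero' = Zero' # s \<and> s \<noteq> []"
    by (simp add: v_letters_def)
  then obtain s where s: "phi u_word v_letters Zero' = Zero' # s" "s \<noteq> []" by blast
  have ne: "phi u_word v_letters d \<noteq> []" for d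
    using length_phi[of d] by (auto split: if_splits)
  have "morph (phi u_word v_letters) (pref cand_letters n) =
    pref cand_letters (length (morph (phi u_word v_letters) (pref cand_letters n)))" for n
    by (cases n) (simp_all only: morph_pref_cand_letters length_pref, simp add: morph_def pref_def)
  moreover have "\<exists>n. m \<le> length (morph (phi u_word v_letters) (pref cand_letters n))" for m
    using length_morph_ge[of "phi u_word v_letters" "pref cand_letters m"] ne by auto
  ultimately have "cand_letters 0 = Zero' \<and> is_morph_image (phi u_word v_letters) cand_letters cand_letters"
    by (simp add: is_morph_image_def cand_letters_def)
  then show ?thesis
    using fixed_word_aux(1)[of "phi u_word v_letters", OF s ne]
      fixed_word[of "phi u_word v_letters", OF s ne] by blast
qed

theorem theorem2p7:
  shows "\<exists>(u :: nat list) (v :: letter list).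
    length u = 55 \<and> length v = 18 \<and>
    hd (phi u v Zero') = Zero' \<and>
    lex_least_word 4 3 = \<tau> \<circ> fixed_word (phi u v) Zero'"
proof (intro exI conjI)
  show "length u_word = 55" "length v_letters = 18" "hd (phi u_word v_letters Zero') = Zero'"
    by (simp_all add: v_letters_def)
  have "cand 0 = 0"
    by (simp add: cand_prefix v_word_def)
  then show "lex_least_word 4 3 = \<tau> \<circ> fixed_word (phi u_word v_letters) Zero'"
    by (auto simp: lex_least_word_4_3 fixed_word_phi cand_letters_def)
qed

end
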